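(* Let $n>2$, $m\ge 2$, $k\in\{1,\dots,n\}$, and $f_k=(e_1+\cdots+e_k)/k$. Construct an $m$-th order Markov chain with transition tensor $P=(p_{i,i_1,\dots,i_m})$ identified with the $n\times n^m$ matrix $P=[P_1\,|\,\cdots\,|\,P_n]$, where each $P_i$ is $n\times n^{m-1}$, so that every column of $P$ equals $f_k$ (call this the base chain for $k$). Then $f_k$ is the only stationary vector of the Markov chain. Moreover: (1) If $k=2$ and, in the base chain for $k$, one replaces the first column of $P_1$ by $e_1$ and all columns of $P_2$ by $e_2$, then the resulting Markov chain has exactly 2 stationary vectors, namely $e_1$ and $e_2$. (2) If $2<k\le n$ and, in the base chain for $k$, for each $i=1,\dots,k$ one replaces the column of $P_i$ indexed by $(i_1,\dots,i_m)=(i,\dots,i)$ by $e_i$ and all other columns of $P_i$ by $e_k$, then the resulting Markov chain has exactly $k$ stationary vectors, namely $e_1,\dots,e_k$. (3) If $k=n$ and, in the base chain for $k=n$, one replaces the column of $P_i$ indexed by $(i_1,\dots,i_m)=(i,\dots,i)$ by $e_i$ for all $i=1,\dots,n$, then the resulting Markov chain has exactly $n+1$ stationary vectors, namely $e_1,\dots,e_n$ and $f_n$. (4) If $k\in\{2,\dots,n-1\}$ and, in the base chain for $k$, for each $i=1,\dots,k$ one replaces the columns of $P_i$ indexed by $(i_1,\dots,i_m)$ with $1\le i_1,\dots,i_m\le k$ by $e_i$, then the set of stationary vectors of the resulting Markov chain equals $\operatorname{conv}\{e_1,\dots,e_k\}$. (5) Suppose $k\in\{2,\dots,n-1\}$ and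 the matrices $P_1,\dots,P_n$ are reset so that, for each $i=1,\dots,n$, the columns of $P_i$ indexed by $(i_1,i_2,\dots,i_m)$ (where $i_1=i$) with $1\le i_2,\dots,i_m\le k$ equal $$v_i=\begin{cases}e_i & \text{if } i=1,\dots,k,\\ (e_{k+1}+\cdots+e_n)/(n-k) & \text{if } i=k+1,\dots,n,\end{cases}$$ and all other columns of $P_i$ equal $f_n=(e_1+\cdots+e_n)/n$. Then the set of stationary vectors of the Markov chain equals $\{f_n\}\cup\operatorname{conv}\{e_1,\dots,e_k\}$.
   Context: $\Omega_n=\{\mathbf{x}=(x_1,\dots,x_n)^t\in\mathbf{R}^n: x_1,\dots,x_n\ge 0,\ \sum_{i=1}^n x_i=1\}$. $e_1,\dots,e_n$ is the standard basis of $\mathbf{R}^n$; $\operatorname{conv}$ denotes convex hull. The transition tensor of an $m$-th order Markov chain on $\{1,\dots,n\}$ is a real array $P=(p_{i,i_1,\dots,i_m})$, $i,i_1,\dots,i_m\in\{1,\dots,n\}$, with nonnegative entries and $\sum_{i=1}^n p_{i,i_1,\dots,i_m}=1$ for all $i_1,\dots,i_m$. It is identified with the $n\times n^m$ matrix with row index $i$ and column indexes $(i_1,\dots,i_m)$ arranged in lexicographic order; thus in the partition $P=[P_1|\cdots|P_n]$ into $n\times n^{m-1}$ blocks, $P_i$ consists of the columns with $i_1=i$, and the first column of $P_1$ is the one indexed by $(1,\dots,1)$. A vector $\mathbf{x}\in\Omega_n$ is a stationary vector if $x_i=\sum_{1\le i_1,\dots,i_m\le n}p_{i,i_1,\dots,i_m}x_{i_1}\cdots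 x_{i_m}$ for $i=1,\dots,n$. *)

theory Defs
  imports "HOL-Analysis.Analysis"
begin

text \<open>Throughout, \<open>\<real>\<^sup>n\<close> is \<open>real ^ 'n\<close>, and \<open>\<iota>\<close> is a bijection from \<open>{1..n}\<close> onto the index type
  \<open>'n\<close> that numbers the coordinates: the coordinate \<open>x\<^sub>i\<close> is \<open>x $ \<iota> i\<close>.  A column index
  \<open>(i\<^sub>1, \<dots>, i\<^sub>m)\<close> is the list \<open>[i\<^sub>1, \<dots>, i\<^sub>m]\<close>.  A tensor is identified with the matrix of its
  columns, \<open>p\<^bsub>i,i\<^sub>1,\<dots>,i\<^sub>m\<^esub> = P [i\<^sub>1, \<dots>, i\<^sub>m] $ \<iota> i\<close>; only the values of \<open>P\<close> on \<open>multi_indices n m\<close> are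
  relevant.  The block \<open>P\<^sub>i\<close> consists of the columns \<open>P js\<close> with \<open>hd js = i\<close>.\<close>

type_synonym 'n tensor = "nat list \<Rightarrow> real ^ 'n"

definition multi_indices :: "nat \<Rightarrow> nat \<Rightarrow> nat list set" where
  "multi_indices n m = {js. length js = m \<and> set js \<subseteq> {1..n}}"

definition std_simplex :: "(nat \<Rightarrow> 'n::finite) \<Rightarrow> nat \<Rightarrow> (real ^ 'n) set" where
  "std_simplex \<iota> n = {x. (\<forall>i\<in>{1..n}. x $ \<iota> i \<ge> 0) \<and> (\<Sum>i=1..n. x $ \<iota> i) = 1}"

definition transition_tensor :: "(nat \<Rightarrow> 'n::finite) \<Rightarrow> nat \<Rightarrow> nat \<Rightarrow> 'n tensor \<Rightarrow> bool" where
  "transition_tensor \<iota> n m P \<longleftrightarrow>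
     (\<forall>js\<in>multi_indices n m.
        (\<forall>i\<in>{1..n}. P js $ \<iota> i \<ge> 0) \<and> (\<Sum>i=1..n. P js $ \<iota> i) = 1)"

definition stationary_vectors ::
    "(nat \<Rightarrow> 'n::finite) \<Rightarrow> nat \<Rightarrow> nat \<Rightarrow> 'n tensor \<Rightarrow> (real ^ 'n) set" where
  "stationary_vectors \<iota> n m P =
     {x \<in> std_simplex \<iota> n. \<forall>i\<in>{1..n}.
        x $ \<iota> i = (\<Sum>js\<in>multi_indices n m. P js $ \<iota> i * (\<Prod>j\<leftarrow>js. x $ \<iota> j))}"

definition e_vec :: "(nat \<Rightarrow> 'n::finite) \<Rightarrow> nat \<Rightarrow> real ^ 'n" where
  "e_vec \<iota> i = axis (\<iota> i) 1"

definition f_vec :: "(nat \<Rightarrow> 'n::finite) \<Rightarrow> nat \<Rightarrow> real ^ 'n" where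
  "f_vec \<iota> k = (1 / real k) *\<^sub>R (\<Sum>i=1..k. e_vec \<iota> i)"

definition base_chain :: "(nat \<Rightarrow> 'n::finite) \<Rightarrow> nat \<Rightarrow> 'n tensor" where
  "base_chain \<iota> k = (\<lambda>js. f_vec \<iota> k)"

definition chain1 :: "(nat \<Rightarrow> 'n::finite) \<Rightarrow> nat \<Rightarrow> nat \<Rightarrow> 'n tensor" where
  "chain1 \<iota> m k = (\<lambda>js.
     if js = replicate m 1 then e_vec \<iota> 1
     else if hd js = 2 then e_vec \<iota> 2
     else base_chain \<iota> k js)"

definition chain2 :: "(nat \<Rightarrow> 'n::finite) \<Rightarrow> nat \<Rightarrow> nat \<Rightarrow> 'n tensor" where
  "chain2 \<iota> m k = (\<lambda>js.
     let i = hd js in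
     if i \<in> {1..k} then (if js = replicate m i then e_vec \<iota> i else e_vec \<iota> k)
     else base_chain \<iota> k js)"

definition chain3 :: "(nat \<Rightarrow> 'n::finite) \<Rightarrow> nat \<Rightarrow> nat \<Rightarrow> 'n tensor" where
  "chain3 \<iota> m k = (\<lambda>js.
     let i = hd js in
     if js = replicate m i then e_vec \<iota> i else base_chain \<iota> k js)"

definition chain4 :: "(nat \<Rightarrow> 'n::finite) \<Rightarrow> nat \<Rightarrow> 'n tensor" where
  "chain4 \<iota> k = (\<lambda>js.
     let i = hd js in
     if set js \<subseteq> {1..k} then e_vec \<iota> i else base_chain \<iota> k js)"

definition v_vec :: "(nat \<Rightarrow> 'n::finite) \<Rightarrow> nat \<Rightarrow> nat \<Rightarrow> nat \<Rightarrow> real ^ 'n" where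
  "v_vec \<iota> n k i =
     (if i \<in> {1..k} then e_vec \<iota> i
      else (1 / real (n - k)) *\<^sub>R (\<Sum>j=k+1..n. e_vec \<iota> j))"

definition chain5 :: "(nat \<Rightarrow> 'n::finite) \<Rightarrow> nat \<Rightarrow> nat \<Rightarrow> 'n tensor" where
  "chain5 \<iota> n k = (\<lambda>js.
     let i = hd js in
     if set (tl js) \<subseteq> {1..k} then v_vec \<iota> n k i else f_vec \<iota> n)"

end

theory Submission
  imports Defs
begin

text \<open>
  For a fixed \<open>x\<close> in the simplex, give the column index \<open>(i\<^sub>1, \<dots>, i\<^sub>m)\<close> the weight
  \<open>x\<^bsub>i\<^sub>1\<^esub> \<cdots> x\<^bsub>i\<^sub>m\<^esub>\<close>.  These weights sum to \<open>1\<close>, and \<open>x\<close> is stationary iff it is the weighted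
  average of the columns.  All six tensors have one shape (\<open>block_chain\<close>): the block \<open>P\<^sub>i\<close> carries
  only two different columns, \<open>u\<^sub>i\<close> where \<open>i\<^sub>2, \<dots>, i\<^sub>m\<close> all lie in a set \<open>A\<^sub>i\<close>, and \<open>v\<^sub>i\<close> elsewhere.
  The first kind has total weight \<open>x\<^sub>i q\<^sub>i\<close> where \<open>q\<^sub>i = (\<Sum>j\<in>A\<^sub>i. x\<^sub>j)\<^bsup>m-1\<^esup>\<close>, so that stationarity is
  the equation \<open>x = \<Sum>\<^sub>i x\<^sub>i (q\<^sub>i u\<^sub>i + (1 - q\<^sub>i) v\<^sub>i)\<close> (\<open>stationary_block_chain_iff\<close>).  Each part of the
  theorem solves this equation for particular data.

  With \<open>A\<^sub>i = {i}\<close> one has \<open>q\<^sub>i = x\<^sub>i\<^bsup>m-1\<^esup>\<close>.  For the first two modified chains, coordinates beyond \<open>k\<close>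
  vanish, and the equations reduce to \<open>x\<^sub>l = x\<^sub>l\<^sup>m\<close> for \<open>l < k\<close>, so \<open>x\<close> is a vertex.  For
  the third one they say that \<open>x\<^sub>l - x\<^sub>l\<^sup>m\<close> has the same value \<open>c\<close> for all \<open>l\<close>.  Either \<open>x\<close> is
  constant, or two coordinates differ; then they sum to at least \<open>1\<close> (\<open>two_values_sum_ge_1\<close>), a
  third coordinate is \<open>0\<close> (here \<open>n > 2\<close> enters), hence \<open>c = 0\<close> and \<open>x\<close> is again a vertex.

  With \<open>A\<^sub>i = {1..k}\<close>, put \<open>s = x\<^sub>1 + \<dots> + x\<^sub>k\<close>.  If \<open>s = 1\<close> then all \<open>q\<^sub>i\<close> equal \<open>1\<close> and the equation
  becomes \<open>x = x\<close>, which gives the whole face \<open>conv {e\<^sub>1, \<dots>, e\<^sub>k}\<close>.  In the fourth chain \<open>s = 1\<close> is forced.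
  In the fifth, \<open>s < 1\<close> turns the equations for \<open>l \<le> k\<close> into \<open>(1 - s\<^bsup>m-1\<^esup>) (x\<^sub>l - 1/n) = 0\<close>, and the
  coordinates beyond \<open>k\<close>, which are all equal, must then be \<open>1/n\<close> as well.
\<close>

section \<open>Coordinates\<close>

locale coordinates =
  fixes \<iota> :: "nat \<Rightarrow> 'n::finite" and n :: nat
  assumes numbering: "bij_betw \<iota> {1..n} (UNIV :: 'n set)"
begin

lemma vec_eqI:
  fixes x y :: "real ^ 'n"
  assumes "\<And>l. l \<in> {1..n} \<Longrightarrow> x $ \<iota> l = y $ \<iota> l"
  shows "x = y"
proof -
  have "x $ a = y $ a" for a
  proof -
    have "a \<in> \<iota> ` {1..n}" using numbering by (simp add: bij_betw_def)
    then show ?thesis using assms by auto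
  qed
  then show ?thesis by (simp add: vec_eq_iff)
qed

lemma e_vec_nth:
  assumes "i \<in> {1..n}" "l \<in> {1..n}"
  shows "e_vec \<iota> i $ \<iota> l = (if l = i then 1 else 0)"
proof -
  have "\<iota> l = \<iota> i \<longleftrightarrow> l = i"
    using numbering assms by (auto simp: bij_betw_def inj_on_eq_iff)
  then show ?thesis by (auto simp: e_vec_def axis_def)
qed

lemma sum_e_vec_nth:
  assumes "I \<subseteq> {1..n}" "l \<in> {1..n}"
  shows "(\<Sum>i\<in>I. c i *\<^sub>R e_vec \<iota> i) $ \<iota> l = (if l \<in> I then c l else 0)"
proof -
  have "(\<Sum>i\<in>I. c i *\<^sub>R e_vec \<iota> i) $ \<iota> l = (\<Sum>i\<in>I. if l = i then c i else 0)"
    using assms by (auto simp: e_vec_nth subset_iff intro!: sum.cong)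
  also have "\<dots> = (if l \<in> I then c l else 0)"
    using finite_subset[OF assms(1)] by simp
  finally show ?thesis .
qed

lemma f_vec_nth:
  assumes "k \<le> n" "l \<in> {1..n}"
  shows "f_vec \<iota> k $ \<iota> l = (if l \<le> k then 1 / real k else 0)"
  using sum_e_vec_nth[of "{1..k}" l "\<lambda>_. 1"] assms by (auto simp: f_vec_def)

lemma v_vec_nth:
  assumes "k < n" "i \<in> {1..n}" "l \<in> {1..n}"
  shows "v_vec \<iota> n k i $ \<iota> l =
    (if i \<le> k then (if l = i then 1 else 0) else (if l \<le> k then 0 else 1 / real (n - k)))"
  using sum_e_vec_nth[of "{k+1..n}" l "\<lambda>_. 1"] assms
  by (auto simp: v_vec_def e_vec_nth)

lemma simplex_sum: "x \<in> std_simplex \<iota> n \<Longrightarrow> (\<Sum>i=1..n. x $ \<iota> i) = 1"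
  by (simp add: std_simplex_def)

lemma simplex_nonneg: "x \<in> std_simplex \<iota> n \<Longrightarrow> i \<in> {1..n} \<Longrightarrow> 0 \<le> x $ \<iota> i"
  by (simp add: std_simplex_def)

lemma e_vec_in_simplex: "i \<in> {1..n} \<Longrightarrow> e_vec \<iota> i \<in> std_simplex \<iota> n"
  by (auto simp: std_simplex_def e_vec_nth)

lemma convex_std_simplex: "convex (std_simplex \<iota> n)"
  unfolding convex_def std_simplex_def
  by (auto simp: sum.distrib simp flip: sum_distrib_left)

lemma uniform_in_simplex:
  assumes "I \<subseteq> {1..n}" "I \<noteq> {}"
  shows "(1 / real (card I)) *\<^sub>R (\<Sum>i\<in>I. e_vec \<iota> i) \<in> std_simplex \<iota> n"
proof -
  have fin: "finite I" using assms(1) finite_subset by blast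
  have "(\<Sum>i\<in>I. (1 / real (card I)) *\<^sub>R e_vec \<iota> i) \<in> std_simplex \<iota> n"
    by (rule convex_sum) (use fin assms convex_std_simplex e_vec_in_simplex in auto)
  then show ?thesis by (simp add: scaleR_sum_right)
qed

lemma f_vec_in_simplex: "k \<in> {1..n} \<Longrightarrow> f_vec \<iota> k \<in> std_simplex \<iota> n"
  using uniform_in_simplex[of "{1..k}"] by (auto simp: f_vec_def)

lemma v_vec_in_simplex:
  assumes "k < n" "i \<in> {1..n}"
  shows "v_vec \<iota> n k i \<in> std_simplex \<iota> n"
  using uniform_in_simplex[of "{k+1..n}"] assms e_vec_in_simplex
  by (auto simp: v_vec_def)

lemma simplex_sum_supported:
  assumes "x \<in> std_simplex \<iota> n" "k \<le> n" "\<And>l. l \<in> {k<..n} \<Longrightarrow> x $ \<iota> l = 0"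
  shows "(\<Sum>i=1..k. x $ \<iota> i) = 1"
proof -
  have "(\<Sum>i=1..k. x $ \<iota> i) = (\<Sum>i=1..n. x $ \<iota> i)"
    by (rule sum.mono_neutral_left) (use assms in auto)
  then show ?thesis using simplex_sum[OF assms(1)] by simp
qed

lemma simplex_coordinate_one:
  assumes "x \<in> std_simplex \<iota> n" "i \<in> {1..n}" "x $ \<iota> i = 1"
  shows "x = e_vec \<iota> i"
proof (rule vec_eqI)
  fix l assume l: "l \<in> {1..n}"
  have "(\<Sum>j\<in>{1..n}-{i}. x $ \<iota> j) = 0"
    using simplex_sum[OF assms(1)] sum.remove[of "{1..n}" i "\<lambda>j. x $ \<iota> j"] assms by simp
  then have "\<forall>j\<in>{1..n}-{i}. x $ \<iota> j = 0"
    using simplex_nonneg[OF assms(1)] by (subst (asm) sum_nonneg_eq_0_iff) auto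
  then show "x $ \<iota> l = e_vec \<iota> i $ \<iota> l"
    using l assms by (auto simp: e_vec_nth)
qed

text \<open>The coordinate \<open>k\<close> may be left out of the last hypothesis: it is what the others leave of the
  total mass \<open>1\<close>.\<close>

lemma simplex_zero_one:
  assumes x: "x \<in> std_simplex \<iota> n" and "k \<le> n" "\<And>l. l \<in> {k<..n} \<Longrightarrow> x $ \<iota> l = 0"
    and "\<And>i. i \<in> {1..<k} \<Longrightarrow> x $ \<iota> i = 0 \<or> x $ \<iota> i = 1"
  shows "x \<in> e_vec \<iota> ` {1..k}"
proof (cases "\<exists>i\<in>{1..<k}. x $ \<iota> i = 1")
  case True
  then obtain i where "i \<in> {1..<k}" "x $ \<iota> i = 1" by blast
  then show ?thesis using simplex_coordinate_one[OF x, of i] \<open>k \<le> n\<close> by auto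
next
  case False
  have s: "(\<Sum>i=1..k. x $ \<iota> i) = 1" using simplex_sum_supported assms by blast
  then have k: "k \<ge> 1" by (cases k) auto
  have "(\<Sum>i=1..k. x $ \<iota> i) = x $ \<iota> k + (\<Sum>i\<in>{1..k}-{k}. x $ \<iota> i)"
    using k by (subst sum.remove[of _ k]) auto
  also have "(\<Sum>i\<in>{1..k}-{k}. x $ \<iota> i) = 0"
    using False assms(4) by (intro sum.neutral) force
  finally have "x $ \<iota> k = 1" using s by simp
  then show ?thesis using simplex_coordinate_one[OF x, of k] k \<open>k \<le> n\<close> by auto
qed

lemma e_vec_inj: "inj_on (e_vec \<iota>) {1..n}"
proof (rule inj_onI)
  fix i j assume "i \<in> {1..n}" "j \<in> {1..n}" "e_vec \<iota> i = e_vec \<iota> j"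
  then show "i = j" using e_vec_nth[of i i] e_vec_nth[of j i] by (auto split: if_splits)
qed

lemma convex_hull_e_vec:
  assumes "k \<le> n"
  shows "convex hull (e_vec \<iota> ` {1..k})
    = {x \<in> std_simplex \<iota> n. \<forall>l\<in>{k<..n}. x $ \<iota> l = 0}" (is "?H = ?F")
proof
  have "e_vec \<iota> ` {1..k} \<subseteq> ?F"
    using assms by (auto simp: e_vec_nth e_vec_in_simplex)
  moreover have "convex ?F"
    using convex_std_simplex unfolding convex_def by auto
  ultimately show "?H \<subseteq> ?F" by (rule hull_minimal)
  show "?F \<subseteq> ?H"
  proof
    fix x assume x: "x \<in> ?F"
    have "x = (\<Sum>i=1..k. (x $ \<iota> i) *\<^sub>R e_vec \<iota> i)"
      using x assms by (intro vec_eqI, subst sum_e_vec_nth) auto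
    also have "\<dots> \<in> ?H"
    proof (rule convex_sum)
      show "(\<Sum>i=1..k. x $ \<iota> i) = 1" using simplex_sum_supported x assms by simp
      show "0 \<le> x $ \<iota> i" if "i \<in> {1..k}" for i
        using simplex_nonneg x that assms by simp
    qed (auto intro: hull_inc)
    finally show "x \<in> ?H" .
  qed
qed

end

section \<open>Sums over column indices\<close>

text \<open>A column index of length \<open>m + 1\<close> is a choice of the block \<open>P\<^sub>i\<close> together with a position
  inside that block; this turns every later sum over columns into a sum over blocks.\<close>

lemma multi_indices_Suc:
  "multi_indices n (Suc m) = (\<lambda>(i, t). i # t) ` ({1..n} \<times> multi_indices n m)"
  by (auto simp: multi_indices_def length_Suc_conv image_iff)

lemma sum_multi_indices_Suc:
  "(\<Sum>js\<in>multi_indices n (Suc m). g js) = (\<Sum>i=1..n. \<Sum>t\<in>multi_indices n m. g (i # t))"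
  unfolding multi_indices_Suc
  by (subst sum.reindex) (auto simp: inj_on_def sum.cartesian_product case_prod_unfold)

lemma multi_indices_length: "js \<in> multi_indices n m \<Longrightarrow> length js = m"
  by (simp add: multi_indices_def)

lemma multi_indices_hd: "m > 0 \<Longrightarrow> js \<in> multi_indices n m \<Longrightarrow> hd js \<in> {1..n}"
  by (cases js) (auto simp: multi_indices_def)

text \<open>A power of a sum, expanded over words: the factor of a word is the product of its letters.\<close>

lemma multi_indices_subset_sum:
  fixes y :: "nat \<Rightarrow> real"
  assumes "A \<subseteq> {1..n}"
  shows "(\<Sum>t\<in>multi_indices n m. if set t \<subseteq> A then \<Prod>j\<leftarrow>t. y j else 0) = (\<Sum>j\<in>A. y j) ^ m"
proof (induction m)
  case 0
  have "multi_indices n 0 = {[]}" by (auto simp: multi_indices_def)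
  then show ?case by simp
next
  case (Suc m)
  let ?w = "\<lambda>t. if set t \<subseteq> A then \<Prod>j\<leftarrow>t. y j else 0"
  have "(\<Sum>t\<in>multi_indices n (Suc m). ?w t)
      = (\<Sum>i=1..n. \<Sum>t\<in>multi_indices n m. (if i \<in> A then y i else 0) * ?w t)"
    unfolding sum_multi_indices_Suc by (intro sum.cong) auto
  also have "\<dots> = (\<Sum>i=1..n. if i \<in> A then y i else 0) * (\<Sum>j\<in>A. y j) ^ m"
    by (simp only: Suc.IH flip: sum_distrib_left sum_distrib_right)
  also have "(\<Sum>i=1..n. if i \<in> A then y i else 0) = (\<Sum>i\<in>A. y i)"
    using assms by (simp add: sum.If_cases Int_absorb1)
  finally show ?case by simp
qed

text \<open>For nonnegative \<open>y\<close>: if the \<open>m\<close> letters of a word are drawn independently from the distribution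
  \<open>y\<close>, all of them fall into \<open>A\<close> with probability \<open>(\<Sum>j\<in>A. y j) ^ m\<close>; the left side is the expectation of a
  quantity that is \<open>a\<close> in that event and \<open>b\<close> otherwise.\<close>

lemma multi_indices_mixture_sum:
  fixes y :: "nat \<Rightarrow> real"
  assumes "A \<subseteq> {1..n}" "(\<Sum>j=1..n. y j) = 1"
  shows "(\<Sum>t\<in>multi_indices n m. (if set t \<subseteq> A then a else b) * (\<Prod>j\<leftarrow>t. y j))
    = (\<Sum>j\<in>A. y j) ^ m * a + (1 - (\<Sum>j\<in>A. y j) ^ m) * b"
proof -
  have tot: "(\<Sum>t\<in>multi_indices n m. \<Prod>j\<leftarrow>t. y j) = 1"
  proof -
    have "(\<Sum>t\<in>multi_indices n m. \<Prod>j\<leftarrow>t. y j)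
        = (\<Sum>t\<in>multi_indices n m. if set t \<subseteq> {1..n} then \<Prod>j\<leftarrow>t. y j else 0)"
      by (rule sum.cong) (auto simp: multi_indices_def)
    then show ?thesis using multi_indices_subset_sum[of "{1..n}" n y m] assms by simp
  qed
  have "(\<Sum>t\<in>multi_indices n m. (if set t \<subseteq> A then a else b) * (\<Prod>j\<leftarrow>t. y j))
      = (\<Sum>t\<in>multi_indices n m. (a - b) * (if set t \<subseteq> A then \<Prod>j\<leftarrow>t. y j else 0)
          + b * (\<Prod>j\<leftarrow>t. y j))"
    by (rule sum.cong) (auto simp: algebra_simps)
  also have "\<dots> = (a - b) * (\<Sum>j\<in>A. y j) ^ m + b"
    by (simp only: sum.distrib tot multi_indices_subset_sum[OF assms(1)] mult_1_right
        flip: sum_distrib_left)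
  finally show ?thesis by (simp add: algebra_simps)
qed

section \<open>Block chains\<close>

text \<open>The common shape of all the chains.  The test is on the tail because the head only selects
  the block.  A condition \<open>js = replicate m i\<close> becomes the choice \<open>A i = {i}\<close>, see
  \<open>eq_replicate_Suc_iff\<close>.\<close>

definition block_chain :: "(nat \<Rightarrow> nat set) \<Rightarrow> (nat \<Rightarrow> real ^ 'n) \<Rightarrow> (nat \<Rightarrow> real ^ 'n) \<Rightarrow> 'n::finite tensor"
  where "block_chain A u v = (\<lambda>js. if set (tl js) \<subseteq> A (hd js) then u (hd js) else v (hd js))"

lemma transition_tensorI:
  assumes "\<And>js. js \<in> multi_indices n m \<Longrightarrow> P js \<in> std_simplex \<iota> n"
  shows "transition_tensor \<iota> n m P"
  using assms by (auto simp: transition_tensor_def std_simplex_def)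

lemma stationary_vectors_cong:
  assumes "\<And>js. js \<in> multi_indices n m \<Longrightarrow> P js = Q js"
  shows "stationary_vectors \<iota> n m P = stationary_vectors \<iota> n m Q"
  unfolding stationary_vectors_def using assms by (auto cong: sum.cong)

lemma eq_replicate_Suc_iff:
  assumes "length js = Suc M"
  shows "js = replicate (Suc M) i \<longleftrightarrow> hd js = i \<and> set (tl js) \<subseteq> {i}"
proof -
  obtain j t where js: "js = j # t" "length t = M" using assms by (auto simp: length_Suc_conv)
  have "t = replicate M i \<longleftrightarrow> set t \<subseteq> {i}"
    using replicate_eqI[OF js(2), of i] by (auto dest: in_set_replicate[THEN iffD1])
  then show ?thesis using js(1) by simp
qed

context coordinates
begin

text \<open>The averages of the two columns over each block, by \<open>multi_indices_mixture_sum\<close> with words of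
  length \<open>M = m - 1\<close>.\<close>

lemma stationary_block_chain_iff:
  assumes "\<And>i. i \<in> {1..n} \<Longrightarrow> A i \<subseteq> {1..n}"
  shows "x \<in> stationary_vectors \<iota> n (Suc M) (block_chain A u v) \<longleftrightarrow>
    x \<in> std_simplex \<iota> n \<and>
    (\<forall>l\<in>{1..n}. x $ \<iota> l = (\<Sum>i=1..n. x $ \<iota> i *
       ((\<Sum>j\<in>A i. x $ \<iota> j) ^ M * u i $ \<iota> l + (1 - (\<Sum>j\<in>A i. x $ \<iota> j) ^ M) * v i $ \<iota> l)))"
proof -
  have "(\<Sum>js\<in>multi_indices n (Suc M). block_chain A u v js $ \<iota> l * (\<Prod>j\<leftarrow>js. x $ \<iota> j))
      = (\<Sum>i=1..n. x $ \<iota> i *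
       ((\<Sum>j\<in>A i. x $ \<iota> j) ^ M * u i $ \<iota> l + (1 - (\<Sum>j\<in>A i. x $ \<iota> j) ^ M) * v i $ \<iota> l))"
    if x: "x \<in> std_simplex \<iota> n" for l
  proof -
    have "(\<Sum>t\<in>multi_indices n M. block_chain A u v (i # t) $ \<iota> l * (\<Prod>j\<leftarrow>i # t. x $ \<iota> j))
        = x $ \<iota> i * ((\<Sum>j\<in>A i. x $ \<iota> j) ^ M * u i $ \<iota> l
            + (1 - (\<Sum>j\<in>A i. x $ \<iota> j) ^ M) * v i $ \<iota> l)" if i: "i \<in> {1..n}" for i
    proof -
      have "(\<Sum>t\<in>multi_indices n M. block_chain A u v (i # t) $ \<iota> l * (\<Prod>j\<leftarrow>i # t. x $ \<iota> j))
          = x $ \<iota> i * (\<Sum>t\<in>multi_indices n M.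
              (if set t \<subseteq> A i then u i $ \<iota> l else v i $ \<iota> l) * (\<Prod>j\<leftarrow>t. x $ \<iota> j))"
        unfolding sum_distrib_left by (rule sum.cong) (auto simp: block_chain_def)
      then show ?thesis
        by (simp only: multi_indices_mixture_sum[OF assms[OF i] simplex_sum[OF x]])
    qed
    then show ?thesis unfolding sum_multi_indices_Suc by (rule sum.cong[OF refl])
  qed
  then show ?thesis unfolding stationary_vectors_def by auto
qed

lemma stationary_singleton_block_chain_iff:
  "x \<in> stationary_vectors \<iota> n (Suc M) (block_chain (\<lambda>i. {i}) u v) \<longleftrightarrow>
    x \<in> std_simplex \<iota> n \<and>
    (\<forall>l\<in>{1..n}. x $ \<iota> l = (\<Sum>i=1..n. x $ \<iota> i *
       ((x $ \<iota> i) ^ M * u i $ \<iota> l + (1 - (x $ \<iota> i) ^ M) * v i $ \<iota> l)))"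
  by (subst stationary_block_chain_iff) simp_all

text \<open>At \<open>x = e\<^sub>s\<close> all the weight is on the single column \<open>(s, \<dots>, s)\<close>.\<close>

lemma absorbing_state_stationary:
  assumes "\<And>i. i \<in> {1..n} \<Longrightarrow> A i \<subseteq> {1..n}"
    and s: "s \<in> {1..n}" "s \<in> A s" "u s = e_vec \<iota> s"
  shows "e_vec \<iota> s \<in> stationary_vectors \<iota> n (Suc M) (block_chain A u v)"
proof -
  have "(\<Sum>j\<in>A s. e_vec \<iota> s $ \<iota> j) = (\<Sum>j\<in>A s. if j = s then 1 else 0)"
    using assms(1)[OF s(1)] s by (intro sum.cong) (auto simp: e_vec_nth)
  then have q: "(\<Sum>j\<in>A s. e_vec \<iota> s $ \<iota> j) = 1"
    using s finite_subset[OF assms(1)[OF s(1)]] by simp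
  have "(\<Sum>i=1..n. e_vec \<iota> s $ \<iota> i * g i) = g s" for g
  proof -
    have "(\<Sum>i=1..n. e_vec \<iota> s $ \<iota> i * g i) = (\<Sum>i=1..n. if i = s then g i else 0)"
      using s by (intro sum.cong) (auto simp: e_vec_nth)
    then show ?thesis using s by simp
  qed
  then show ?thesis
    using s q by (subst stationary_block_chain_iff[OF assms(1)]) (simp_all add: e_vec_in_simplex)
qed

section \<open>A single stationary vector or a simplex of them\<close>

lemma stationary_base_chain:
  assumes k: "k \<in> {1..n}"
  shows "stationary_vectors \<iota> n (Suc M) (base_chain \<iota> k) = {f_vec \<iota> k}"
proof -
  have "base_chain \<iota> k = block_chain (\<lambda>_. {}) (\<lambda>_. f_vec \<iota> k) (\<lambda>_. f_vec \<iota> k)"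
    by (auto simp: base_chain_def block_chain_def)
  moreover have "x \<in> stationary_vectors \<iota> n (Suc M)
      (block_chain (\<lambda>_. {}) (\<lambda>_. f_vec \<iota> k) (\<lambda>_. f_vec \<iota> k)) \<longleftrightarrow> x = f_vec \<iota> k" for x
  proof -
    have "x \<in> stationary_vectors \<iota> n (Suc M)
        (block_chain (\<lambda>_. {}) (\<lambda>_. f_vec \<iota> k) (\<lambda>_. f_vec \<iota> k)) \<longleftrightarrow>
      x \<in> std_simplex \<iota> n \<and> (\<forall>l\<in>{1..n}. x $ \<iota> l = f_vec \<iota> k $ \<iota> l)"
      using simplex_sum[of x]
      by (subst stationary_block_chain_iff)
         (auto simp: algebra_simps simp flip: sum_distrib_left)
    then show ?thesis using vec_eqI[of x "f_vec \<iota> k"] f_vec_in_simplex[OF k] by blast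
  qed
  ultimately show ?thesis by auto
qed

text \<open>No column has mass beyond \<open>k\<close>, so a stationary vector is supported on the first \<open>k\<close> states; on
  that face only the columns \<open>e\<^bsub>i\<^sub>1\<^esub>\<close> have positive weight, and averaging them gives back \<open>x\<close>.\<close>

lemma stationary_chain4:
  assumes k: "k \<in> {1..n}"
  shows "stationary_vectors \<iota> n (Suc M) (chain4 \<iota> k) = convex hull (e_vec \<iota> ` {1..k})"
proof -
  define u where "u i = (if i \<in> {1..k} then e_vec \<iota> i else f_vec \<iota> k)" for i :: nat
  let ?A = "\<lambda>i::nat. {1..k}"
  let ?S = "stationary_vectors \<iota> n (Suc M) (block_chain ?A u (\<lambda>_. f_vec \<iota> k))"
  have chain: "stationary_vectors \<iota> n (Suc M) (chain4 \<iota> k) = ?S"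
    by (rule stationary_vectors_cong)
       (auto simp: multi_indices_Suc chain4_def base_chain_def block_chain_def u_def Let_def)
  have iff: "x \<in> ?S \<longleftrightarrow> x \<in> std_simplex \<iota> n \<and> (\<forall>l\<in>{1..n}. x $ \<iota> l = (\<Sum>i=1..n. x $ \<iota> i *
       ((\<Sum>j=1..k. x $ \<iota> j) ^ M * u i $ \<iota> l + (1 - (\<Sum>j=1..k. x $ \<iota> j) ^ M) * f_vec \<iota> k $ \<iota> l)))"
    for x
    using k by (subst stationary_block_chain_iff) auto
  have "x \<in> ?S \<longleftrightarrow> x \<in> std_simplex \<iota> n \<and> (\<forall>l\<in>{k<..n}. x $ \<iota> l = 0)" for x
  proof (cases "x \<in> std_simplex \<iota> n")
    case sx: True
    show ?thesis
    proof
      assume S: "x \<in> ?S"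
      have "x $ \<iota> l = 0" if l: "l \<in> {k<..n}" for l
      proof -
        have ln: "l \<in> {1..n}" using l by simp
        have "x $ \<iota> l = (\<Sum>i=1..n. x $ \<iota> i *
          ((\<Sum>j=1..k. x $ \<iota> j) ^ M * u i $ \<iota> l + (1 - (\<Sum>j=1..k. x $ \<iota> j) ^ M) * f_vec \<iota> k $ \<iota> l))"
          using S ln unfolding iff by blast
        also have "\<dots> = 0"
          using l k by (intro sum.neutral) (auto simp: u_def e_vec_nth f_vec_nth)
        finally show ?thesis .
      qed
      then show "x \<in> std_simplex \<iota> n \<and> (\<forall>l\<in>{k<..n}. x $ \<iota> l = 0)" using sx by blast
    next
      assume supp: "x \<in> std_simplex \<iota> n \<and> (\<forall>l\<in>{k<..n}. x $ \<iota> l = 0)"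
      have s: "(\<Sum>j=1..k. x $ \<iota> j) = 1" using simplex_sum_supported supp k by auto
      have "(\<Sum>i=1..n. x $ \<iota> i * u i $ \<iota> l) = x $ \<iota> l" if l: "l \<in> {1..n}" for l
      proof -
        have "(\<Sum>i=1..n. x $ \<iota> i * u i $ \<iota> l) = (\<Sum>i=1..n. if l = i then x $ \<iota> i else 0)"
          using l supp k by (intro sum.cong) (auto simp: u_def e_vec_nth f_vec_nth)
        then show ?thesis using l by simp
      qed
      then show "x \<in> ?S" unfolding iff using supp s by simp
    qed
  qed (simp add: stationary_vectors_def)
  then show ?thesis unfolding chain using k by (subst convex_hull_e_vec) auto
qed

text \<open>Here mass beyond \<open>k\<close> is possible, and \<open>s x\<close>, the mass of the first \<open>k\<close> states, separates the two
  kinds of solutions.\<close>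

lemma stationary_chain5:
  assumes k: "k < n" and M: "M \<ge> 1"
  shows "stationary_vectors \<iota> n (Suc M) (chain5 \<iota> n k)
    = {f_vec \<iota> n} \<union> convex hull (e_vec \<iota> ` {1..k})"
proof -
  let ?S = "stationary_vectors \<iota> n (Suc M) (block_chain (\<lambda>_. {1..k}) (v_vec \<iota> n k) (\<lambda>_. f_vec \<iota> n))"
  have chain: "stationary_vectors \<iota> n (Suc M) (chain5 \<iota> n k) = ?S"
    by (simp add: chain5_def block_chain_def Let_def)
  define s where "s x = (\<Sum>j=1..k. x $ \<iota> j)" for x :: "real ^ 'n"
  have iff: "x \<in> ?S \<longleftrightarrow> x \<in> std_simplex \<iota> n \<and>
      (\<forall>l\<in>{1..k}. x $ \<iota> l = s x ^ M * x $ \<iota> l + (1 - s x ^ M) / real n) \<and>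
      (\<forall>l\<in>{k<..n}. x $ \<iota> l = s x ^ M * ((1 - s x) / real (n - k)) + (1 - s x ^ M) / real n)" for x
  proof (cases "x \<in> std_simplex \<iota> n")
    case sx: True
    have eq: "(\<Sum>i=1..n. x $ \<iota> i * (s x ^ M * v_vec \<iota> n k i $ \<iota> l + (1 - s x ^ M) * f_vec \<iota> n $ \<iota> l))
        = s x ^ M * (\<Sum>i=1..n. x $ \<iota> i * v_vec \<iota> n k i $ \<iota> l) + (1 - s x ^ M) / real n"
      if l: "l \<in> {1..n}" for l
    proof -
      have "(\<Sum>i=1..n. x $ \<iota> i * (s x ^ M * v_vec \<iota> n k i $ \<iota> l + (1 - s x ^ M) * f_vec \<iota> n $ \<iota> l))
        = s x ^ M * (\<Sum>i=1..n. x $ \<iota> i * v_vec \<iota> n k i $ \<iota> l)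
          + (\<Sum>i=1..n. x $ \<iota> i) * ((1 - s x ^ M) / real n)"
        using l by (simp add: f_vec_nth distrib_left sum.distrib sum_distrib_left
            sum_distrib_right mult_ac)
      then show ?thesis using simplex_sum[OF sx] by simp
    qed
    have low: "(\<Sum>i=1..n. x $ \<iota> i * v_vec \<iota> n k i $ \<iota> l) = x $ \<iota> l" if l: "l \<in> {1..k}" for l
    proof -
      have "(\<Sum>i=1..n. x $ \<iota> i * v_vec \<iota> n k i $ \<iota> l) = (\<Sum>i=1..n. if l = i then x $ \<iota> i else 0)"
        using l k by (intro sum.cong) (auto simp: v_vec_nth)
      then show ?thesis using l k by simp
    qed
    have high: "(\<Sum>i=1..n. x $ \<iota> i * v_vec \<iota> n k i $ \<iota> l) = (1 - s x) / real (n - k)"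
      if l: "l \<in> {k<..n}" for l
    proof -
      have "(\<Sum>i=1..n. x $ \<iota> i * v_vec \<iota> n k i $ \<iota> l) = (\<Sum>i\<in>{k<..n}. x $ \<iota> i / real (n - k))"
        using l k by (intro sum.mono_neutral_cong_right) (auto simp: v_vec_nth)
      also have "\<dots> = (\<Sum>i\<in>{k<..n}. x $ \<iota> i) / real (n - k)"
        by (simp add: sum_divide_distrib)
      also have "(\<Sum>i\<in>{k<..n}. x $ \<iota> i) = 1 - s x"
      proof -
        have "{1..n} = {1..k} \<union> {k<..n}" using k by auto
        then have "(\<Sum>i=1..n. x $ \<iota> i) = s x + (\<Sum>i\<in>{k<..n}. x $ \<iota> i)"
          unfolding s_def by (subst sum.union_disjoint[symmetric]) auto
        then show ?thesis using simplex_sum[OF sx] by simp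
      qed
      finally show ?thesis .
    qed
    have "x \<in> ?S \<longleftrightarrow> (\<forall>l\<in>{1..n}. x $ \<iota> l =
        s x ^ M * (\<Sum>i=1..n. x $ \<iota> i * v_vec \<iota> n k i $ \<iota> l) + (1 - s x ^ M) / real n)"
      (is "_ \<longleftrightarrow> (\<forall>l\<in>{1..n}. ?Q l)")
      using k sx eq by (subst stationary_block_chain_iff) (auto simp: s_def)
    also have "\<dots> \<longleftrightarrow> (\<forall>l\<in>{1..k}. ?Q l) \<and> (\<forall>l\<in>{k<..n}. ?Q l)"
      using k unfolding ball_Un[symmetric] by (intro arg_cong[where f = "\<lambda>I. \<forall>l\<in>I. ?Q l"]) auto
    finally show ?thesis using sx by (simp only: low high cong: ball_cong) simp
  qed (simp add: stationary_vectors_def)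
  have "x \<in> ?S \<longleftrightarrow> x = f_vec \<iota> n \<or> x \<in> convex hull (e_vec \<iota> ` {1..k})" for x
  proof
    assume "x \<in> ?S"
    then have sx: "x \<in> std_simplex \<iota> n"
      and low: "\<And>l. l \<in> {1..k} \<Longrightarrow> x $ \<iota> l = s x ^ M * x $ \<iota> l + (1 - s x ^ M) / real n"
      and high: "\<And>l. l \<in> {k<..n} \<Longrightarrow>
        x $ \<iota> l = s x ^ M * ((1 - s x) / real (n - k)) + (1 - s x ^ M) / real n"
      unfolding iff by auto
    have s0: "s x \<ge> 0" unfolding s_def using simplex_nonneg[OF sx] k by (auto intro!: sum_nonneg)
    show "x = f_vec \<iota> n \<or> x \<in> convex hull (e_vec \<iota> ` {1..k})"
    proof (cases "s x ^ M = 1")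
      case True
      then have "s x = 1" using s0 M power_eq_1_iff[of "s x" M] by auto
      then have "\<forall>l\<in>{k<..n}. x $ \<iota> l = 0" using high by simp
      then show ?thesis using sx k convex_hull_e_vec[of k] by auto
    next
      case False
      have lowv: "x $ \<iota> l = 1 / real n" if "l \<in> {1..k}" for l
      proof -
        have "(1 - s x ^ M) * (x $ \<iota> l - 1 / real n) = 0"
          using low[OF that] by (simp add: field_simps)
        then show ?thesis using False by simp
      qed
      then have s: "s x = real k / real n" by (simp add: s_def)
      have highv: "x $ \<iota> l = 1 / real n" if "l \<in> {k<..n}" for l
      proof -
        have "(1 - s x) / real (n - k) = 1 / real n"
          using k unfolding s by (simp add: field_simps of_nat_diff)
        then show ?thesis using high[OF that] by (simp flip: add_divide_distrib)
      qed
      have "x = f_vec \<iota> n"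
      proof (rule vec_eqI)
        fix l assume "l \<in> {1..n}"
        then show "x $ \<iota> l = f_vec \<iota> n $ \<iota> l"
          using lowv[of l] highv[of l] by (cases "l \<le> k") (auto simp: f_vec_nth)
      qed
      then show ?thesis by blast
    qed
  next
    assume "x = f_vec \<iota> n \<or> x \<in> convex hull (e_vec \<iota> ` {1..k})"
    then show "x \<in> ?S"
    proof
      assume x: "x = f_vec \<iota> n"
      have "s x = real k / real n" using k by (simp add: s_def x f_vec_nth)
      then have "(1 - s x) / real (n - k) = 1 / real n"
        using k by (simp add: field_simps of_nat_diff)
      then show ?thesis
        using k f_vec_in_simplex[of n] unfolding iff by (auto simp: x f_vec_nth field_simps)
    next
      assume "x \<in> convex hull (e_vec \<iota> ` {1..k})"
      then have x: "x \<in> std_simplex \<iota> n" "\<forall>l\<in>{k<..n}. x $ \<iota> l = 0"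
        using k convex_hull_e_vec[of k] by auto
      then have "s x = 1" using simplex_sum_supported[of x k] k by (simp add: s_def)
      then show ?thesis using x unfolding iff by simp
    qed
  qed
  then show ?thesis unfolding chain by auto
qed

end

section \<open>Finitely many stationary vectors\<close>

text \<open>The hypothesis says \<open>b\<^sup>m - a\<^sup>m = b - a\<close> with \<open>m = M + 1\<close>.  On the other hand
  \<open>(b\<^sup>m - a\<^sup>m) / (b - a)\<close> is a sum of monomials of degree \<open>M\<close> that occur in the expansion of
  \<open>(a + b)\<^sup>M\<close>, so \<open>a + b < 1\<close> would make it less than \<open>1\<close>.\<close>

lemma two_values_sum_ge_1:
  fixes a b :: real
  assumes ab: "0 \<le> a" "a < b" and M: "M \<ge> 1" and eq: "a - a ^ Suc M = b - b ^ Suc M"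
  shows "a + b \<ge> 1"
proof (rule ccontr)
  assume "\<not> a + b \<ge> 1"
  then have lt: "(a + b) ^ M < 1" using ab M by (simp add: power_less_one_iff)
  have "b ^ Suc j - a ^ Suc j \<le> (b - a) * (a + b) ^ j" for j
  proof (induction j)
    case (Suc j)
    have "b ^ Suc (Suc j) - a ^ Suc (Suc j) = b * (b ^ Suc j - a ^ Suc j) + (b - a) * (a * a ^ j)"
      by (simp add: algebra_simps)
    also have "\<dots> \<le> b * ((b - a) * (a + b) ^ j) + (b - a) * (a * (a + b) ^ j)"
      using Suc ab by (intro add_mono mult_left_mono power_mono) auto
    also have "\<dots> = (b - a) * (a + b) ^ Suc j" by (simp add: algebra_simps)
    finally show ?case .
  qed simp
  from this[of M] have "(b - a) * 1 \<le> (b - a) * (a + b) ^ M" using eq by simp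
  then show False using lt ab by (simp add: mult_le_cancel_left)
qed

context coordinates
begin

text \<open>State \<open>2\<close> absorbs everything that enters its block, whereas block \<open>1\<close> passes on half of the
  weight of its columns other than the first; the balance at state \<open>1\<close> therefore reads
  \<open>x\<^sub>1 (1 - x\<^sub>1\<^bsup>m-1\<^esup>) = 0\<close>.\<close>

lemma stationary_chain1:
  assumes n: "n > 2" and M: "M \<ge> 1"
  shows "stationary_vectors \<iota> n (Suc M) (chain1 \<iota> (Suc M) 2) = {e_vec \<iota> 1, e_vec \<iota> 2}"
proof -
  define u where "u i = (if i \<in> {1,2} then e_vec \<iota> i else f_vec \<iota> 2)" for i :: nat
  define v where "v i = (if i = 2 then e_vec \<iota> 2 else f_vec \<iota> 2)" for i :: nat
  let ?A = "\<lambda>i::nat. {i}"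
  let ?S = "stationary_vectors \<iota> n (Suc M) (block_chain ?A u v)"
  have "stationary_vectors \<iota> n (Suc M) (chain1 \<iota> (Suc M) 2) = ?S"
    by (rule stationary_vectors_cong)
       (simp add: chain1_def base_chain_def block_chain_def u_def v_def
         eq_replicate_Suc_iff[OF multi_indices_length] del: replicate_Suc)
  moreover have "x \<in> e_vec \<iota> ` {1..2}" if x: "x \<in> ?S" for x
  proof -
    have sx: "x \<in> std_simplex \<iota> n" and
      eq: "\<And>l. l \<in> {1..n} \<Longrightarrow> x $ \<iota> l = (\<Sum>i=1..n. x $ \<iota> i *
       ((x $ \<iota> i) ^ M * u i $ \<iota> l + (1 - (x $ \<iota> i) ^ M) * v i $ \<iota> l))"
      using x unfolding stationary_singleton_block_chain_iff by blast+
    have supp: "x $ \<iota> l = 0" if l: "l \<in> {2<..n}" for l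
      using l n by (subst eq) (auto simp: u_def v_def e_vec_nth f_vec_nth intro!: sum.neutral)
    have "x $ \<iota> 1 = (\<Sum>i\<in>{1,2}. x $ \<iota> i *
       ((x $ \<iota> i) ^ M * u i $ \<iota> 1 + (1 - (x $ \<iota> i) ^ M) * v i $ \<iota> 1))"
      using n by (subst eq, simp) (rule sum.mono_neutral_right, auto simp: supp)
    then have "x $ \<iota> 1 = x $ \<iota> 1 * ((x $ \<iota> 1) ^ M + (1 - (x $ \<iota> 1) ^ M) / 2)"
      using n by (simp add: u_def v_def e_vec_nth f_vec_nth)
    then have "x $ \<iota> 1 * (1 - (x $ \<iota> 1) ^ M) = 0" by (simp add: field_simps)
    then have "x $ \<iota> 1 = 0 \<or> x $ \<iota> 1 = 1"
      using simplex_nonneg[OF sx, of 1] n M power_eq_1_iff[of "x $ \<iota> 1" M]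
      by auto
    then show ?thesis
      using n supp by (intro simplex_zero_one[OF sx]) (auto simp: less_Suc_eq numeral_2_eq_2)
  qed
  moreover have "e_vec \<iota> i \<in> ?S" if "i \<in> {1,2}" for i
    using that n by (intro absorbing_state_stationary) (auto simp: u_def)
  moreover have "{1..2::nat} = {1,2}" by auto
  ultimately show ?thesis by auto
qed

text \<open>The columns \<open>e\<^sub>k\<close> divert all mixed weight to state \<open>k\<close>, so a state \<open>l < k\<close> is entered only from
  \<open>(l, \<dots>, l)\<close>, which means \<open>x\<^sub>l = x\<^sub>l\<^sup>m\<close>.\<close>

lemma stationary_chain2:
  assumes k: "1 \<le> k" "k \<le> n" and M: "M \<ge> 1"
  shows "stationary_vectors \<iota> n (Suc M) (chain2 \<iota> (Suc M) k) = e_vec \<iota> ` {1..k}"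
proof -
  define u where "u i = (if i \<in> {1..k} then e_vec \<iota> i else f_vec \<iota> k)" for i :: nat
  define v where "v i = (if i \<in> {1..k} then e_vec \<iota> k else f_vec \<iota> k)" for i :: nat
  let ?A = "\<lambda>i::nat. {i}"
  let ?S = "stationary_vectors \<iota> n (Suc M) (block_chain ?A u v)"
  have "stationary_vectors \<iota> n (Suc M) (chain2 \<iota> (Suc M) k) = ?S"
    by (rule stationary_vectors_cong)
       (simp add: chain2_def base_chain_def block_chain_def u_def v_def
         eq_replicate_Suc_iff[OF multi_indices_length] Let_def del: replicate_Suc)
  moreover have "x \<in> e_vec \<iota> ` {1..k}" if x: "x \<in> ?S" for x
  proof -
    have sx: "x \<in> std_simplex \<iota> n" and
      eq: "\<And>l. l \<in> {1..n} \<Longrightarrow> x $ \<iota> l = (\<Sum>i=1..n. x $ \<iota> i *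
       ((x $ \<iota> i) ^ M * u i $ \<iota> l + (1 - (x $ \<iota> i) ^ M) * v i $ \<iota> l))"
      using x unfolding stationary_singleton_block_chain_iff by blast+
    have supp: "x $ \<iota> l = 0" if l: "l \<in> {k<..n}" for l
      using l k by (subst eq) (auto simp: u_def v_def e_vec_nth f_vec_nth intro!: sum.neutral)
    have "x $ \<iota> l = 0 \<or> x $ \<iota> l = 1" if l: "l \<in> {1..<k}" for l
    proof -
      have "x $ \<iota> l = (\<Sum>i=1..n. if l = i then x $ \<iota> i * (x $ \<iota> i) ^ M else 0)"
        using l k by (subst eq, simp, intro sum.cong)
          (auto simp: u_def v_def e_vec_nth f_vec_nth supp)
      then have "x $ \<iota> l = x $ \<iota> l * (x $ \<iota> l) ^ M"
        using l k by simp
      then show ?thesis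
        using simplex_nonneg[OF sx, of l] l k M power_eq_1_iff[of "x $ \<iota> l" M] by auto
    qed
    then show ?thesis using k supp by (intro simplex_zero_one[OF sx]) auto
  qed
  moreover have "e_vec \<iota> i \<in> ?S" if "i \<in> {1..k}" for i
    using that k by (intro absorbing_state_stationary) (auto simp: u_def)
  ultimately show ?thesis by auto
qed

text \<open>The mixed weight is spread evenly over all states, so \<open>x\<^sub>l - x\<^sub>l\<^sup>m\<close> is independent of \<open>l\<close>.\<close>

lemma stationary_chain3:
  assumes n: "n > 2" and M: "M \<ge> 1"
  shows "stationary_vectors \<iota> n (Suc M) (chain3 \<iota> (Suc M) n) = e_vec \<iota> ` {1..n} \<union> {f_vec \<iota> n}"
proof -
  let ?A = "\<lambda>i::nat. {i}"
  let ?S = "stationary_vectors \<iota> n (Suc M) (block_chain ?A (e_vec \<iota>) (\<lambda>_. f_vec \<iota> n))"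
  have chain: "stationary_vectors \<iota> n (Suc M) (chain3 \<iota> (Suc M) n) = ?S"
    by (rule stationary_vectors_cong)
       (simp add: chain3_def base_chain_def block_chain_def
         eq_replicate_Suc_iff[OF multi_indices_length] Let_def del: replicate_Suc)
  have iff: "x \<in> ?S \<longleftrightarrow> x \<in> std_simplex \<iota> n \<and>
      (\<forall>l\<in>{1..n}. x $ \<iota> l = (x $ \<iota> l) ^ Suc M + (\<Sum>i=1..n. x $ \<iota> i * ((1 - (x $ \<iota> i) ^ M) / real n)))"
    for x
  proof -
    have "(\<Sum>i=1..n. x $ \<iota> i *
       ((x $ \<iota> i) ^ M * e_vec \<iota> i $ \<iota> l + (1 - (x $ \<iota> i) ^ M) * f_vec \<iota> n $ \<iota> l))
      = (x $ \<iota> l) ^ Suc M + (\<Sum>i=1..n. x $ \<iota> i * ((1 - (x $ \<iota> i) ^ M) / real n))"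
      if l: "l \<in> {1..n}" for l
    proof -
      have "(\<Sum>i=1..n. x $ \<iota> i *
         ((x $ \<iota> i) ^ M * e_vec \<iota> i $ \<iota> l + (1 - (x $ \<iota> i) ^ M) * f_vec \<iota> n $ \<iota> l))
        = (\<Sum>i=1..n. (if l = i then (x $ \<iota> i) ^ Suc M else 0)
            + x $ \<iota> i * ((1 - (x $ \<iota> i) ^ M) / real n))"
        using l by (intro sum.cong) (auto simp: e_vec_nth f_vec_nth distrib_left)
      then show ?thesis using l by (simp add: sum.distrib)
    qed
    then show ?thesis unfolding stationary_singleton_block_chain_iff by simp
  qed
  have "x \<in> e_vec \<iota> ` {1..n} \<union> {f_vec \<iota> n}" if "x \<in> ?S" for x
  proof -
    define c where "c = (\<Sum>i=1..n. x $ \<iota> i * ((1 - (x $ \<iota> i) ^ M) / real n))"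
    have sx: "x \<in> std_simplex \<iota> n" and
      eq: "\<And>l. l \<in> {1..n} \<Longrightarrow> x $ \<iota> l - (x $ \<iota> l) ^ Suc M = c"
      using that unfolding iff c_def by (auto simp: algebra_simps)
    show ?thesis
    proof (cases "\<exists>a\<in>{1..n}. \<exists>b\<in>{1..n}. x $ \<iota> a < x $ \<iota> b")
      case True
      then obtain a b where ab: "a \<in> {1..n}" "b \<in> {1..n}" "x $ \<iota> a < x $ \<iota> b" by blast
      have ge: "x $ \<iota> a + x $ \<iota> b \<ge> 1"
        by (rule two_values_sum_ge_1[OF simplex_nonneg[OF sx ab(1)] ab(3) M])
           (simp only: eq ab)
      \<comment> \<open>The coordinates \<open>a\<close> and \<open>b\<close> exhaust the mass, so a third coordinate, with value \<open>0\<close>, shows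
        that the common value \<open>c\<close> is \<open>0\<close>.\<close>
      have "card {a, b} < card {1..n}" using n by (auto simp: card_insert_if)
      then have "\<not> {1..n} \<subseteq> {a, b}" by (metis card_mono finite.emptyI finite.insertI leD)
      then obtain d where d: "d \<in> {1..n}" "d \<noteq> a" "d \<noteq> b" by blast
      have "a \<noteq> b" using ab(3) by auto
      have "(\<Sum>i\<in>{a,b,d}. x $ \<iota> i) \<le> (\<Sum>i=1..n. x $ \<iota> i)"
        using ab d simplex_nonneg[OF sx] by (intro sum_mono2) auto
      then have "x $ \<iota> a + x $ \<iota> b + x $ \<iota> d \<le> 1"
        using d \<open>a \<noteq> b\<close> simplex_sum[OF sx] by (simp add: add.assoc)
      then have "x $ \<iota> d = 0" using ge simplex_nonneg[OF sx d(1)] by simp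
      then have "c = 0" using eq[OF d(1)] by simp
      then have "x $ \<iota> l = 0 \<or> x $ \<iota> l = 1" if "l \<in> {1..n}" for l
        using eq[OF that] simplex_nonneg[OF sx that] M power_eq_1_iff[of "x $ \<iota> l" M] by auto
      then show ?thesis using simplex_zero_one[OF sx, of n] by auto
    next
      case False
      have "x = f_vec \<iota> n"
      proof (rule vec_eqI)
        fix l assume l: "l \<in> {1..n}"
        have "(\<Sum>i=1..n. x $ \<iota> i) = (\<Sum>i=1..n. x $ \<iota> l)"
          using False l by (intro sum.cong) (auto simp: not_less intro: antisym)
        then show "x $ \<iota> l = f_vec \<iota> n $ \<iota> l"
          using simplex_sum[OF sx] l by (auto simp: f_vec_nth field_simps)
      qed
      then show ?thesis by simp
    qed
  qed
  moreover have "e_vec \<iota> i \<in> ?S" if "i \<in> {1..n}" for i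
    using that by (intro absorbing_state_stationary) auto
  moreover have "f_vec \<iota> n \<in> ?S"
    using n f_vec_in_simplex[of n] unfolding iff by (auto simp: f_vec_nth field_simps)
  ultimately show ?thesis unfolding chain by auto
qed

end

theorem theorem3p2:
  fixes n m k :: nat and \<iota> :: "nat \<Rightarrow> 'n::finite"
  assumes numbering: "bij_betw \<iota> {1..n} (UNIV :: 'n set)"
    and n: "n > 2" and m: "m \<ge> 2" and k: "k \<in> {1..n}"
  shows
    "(transition_tensor \<iota> n m (base_chain \<iota> k) \<and>
      stationary_vectors \<iota> n m (base_chain \<iota> k) = {f_vec \<iota> k}) \<and>
     (k = 2 \<longrightarrow>
        transition_tensor \<iota> n m (chain1 \<iota> m k) \<and>
        stationary_vectors \<iota> n m (chain1 \<iota> m k) = {e_vec \<iota> 1, e_vec \<iota> 2} \<and>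
        card (stationary_vectors \<iota> n m (chain1 \<iota> m k)) = 2) \<and>
     (2 < k \<and> k \<le> n \<longrightarrow>
        transition_tensor \<iota> n m (chain2 \<iota> m k) \<and>
        stationary_vectors \<iota> n m (chain2 \<iota> m k) = e_vec \<iota> ` {1..k} \<and>
        card (stationary_vectors \<iota> n m (chain2 \<iota> m k)) = k) \<and>
     (k = n \<longrightarrow>
        transition_tensor \<iota> n m (chain3 \<iota> m k) \<and>
        stationary_vectors \<iota> n m (chain3 \<iota> m k) = e_vec \<iota> ` {1..n} \<union> {f_vec \<iota> n} \<and>
        card (stationary_vectors \<iota> n m (chain3 \<iota> m k)) = n + 1) \<and>
     (k \<in> {2..n - 1} \<longrightarrow>
        transition_tensor \<iota> n m (chain4 \<iota> k) \<and>
        stationary_vectors \<iota> n m (chain4 \<iota> k) = convex hull (e_vec \<iota> ` {1..k})) \<and>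
     (k \<in> {2..n - 1} \<longrightarrow>
        transition_tensor \<iota> n m (chain5 \<iota> n k) \<and>
        stationary_vectors \<iota> n m (chain5 \<iota> n k) = {f_vec \<iota> n} \<union> convex hull (e_vec \<iota> ` {1..k}))"
proof -
  interpret coordinates \<iota> n by unfold_locales (rule numbering)
  obtain M where M: "m = Suc M" "M \<ge> 1" using m by (cases m) auto
  note hd_in = multi_indices_hd[of m]
  have in_simplex: "i \<in> {1..n} \<Longrightarrow> e_vec \<iota> i \<in> std_simplex \<iota> n"
    "i \<in> {1..n} \<Longrightarrow> f_vec \<iota> i \<in> std_simplex \<iota> n" for i
    by (rule e_vec_in_simplex f_vec_in_simplex, assumption)+
  have "transition_tensor \<iota> n m (base_chain \<iota> k)"
    "k = 2 \<Longrightarrow> transition_tensor \<iota> n m (chain1 \<iota> m k)"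
    "transition_tensor \<iota> n m (chain2 \<iota> m k)"
    "transition_tensor \<iota> n m (chain3 \<iota> m k)"
    "transition_tensor \<iota> n m (chain4 \<iota> k)"
    "k < n \<Longrightarrow> transition_tensor \<iota> n m (chain5 \<iota> n k)"
    using k n m hd_in
    by (auto intro!: transition_tensorI in_simplex v_vec_in_simplex
        simp: base_chain_def chain1_def chain2_def chain3_def chain4_def chain5_def Let_def)
  moreover have "card {e_vec \<iota> 1, e_vec \<iota> 2} = 2"
    using inj_on_eq_iff[OF e_vec_inj, of 1 2] n by simp
  moreover have "card (e_vec \<iota> ` {1..j}) = j" if "j \<le> n" for j
    using card_image[OF inj_on_subset[OF e_vec_inj], of "{1..j}"] that by simp
  moreover have "f_vec \<iota> n \<notin> e_vec \<iota> ` {1..n}"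
  proof
    assume "f_vec \<iota> n \<in> e_vec \<iota> ` {1..n}"
    then obtain i where i: "i \<in> {1..n}" "f_vec \<iota> n = e_vec \<iota> i" by blast
    then have "1 / real n = 1" using e_vec_nth[of i i] f_vec_nth[of n i] by simp
    then show False using n by simp
  qed
  ultimately show ?thesis
    using n k M(2) unfolding M(1)
    by (intro conjI impI)
      (auto simp: stationary_base_chain stationary_chain1[simplified] stationary_chain2[simplified]
        stationary_chain3[simplified] stationary_chain4[simplified] stationary_chain5[simplified])
qed

end
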